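(* Let $G$ be an $r$-colored graph that is vertex transitive, and suppose that $Aut(G) = A\wr B$ (up to permutation isomorphism) for some permutation groups $(A,V)$ and $(B,W)$. Then there exist $r$-colored graphs $H_1$ and $H_2$ such that $Aut(H_1)=A$, $Aut(H_2)=B$, and $G = H_2\circ H_1$ (up to isomorphism).
   Context: An $r$-colored graph is a pair $(V,E)$ where $E$ is a function from the set $P_2(V)$ of unordered pairs of distinct vertices to a set of $r$ colors; an automorphism is a permutation $\sigma$ of $V$ with $E\{v,w\}=E\{v\sigma,w\sigma\}$ for all $v\ne w$, and $Aut(G)$ is regarded as a permutation group on the vertex set. Permutations act on the right. Permutation groups are considered up to permutation isomorphism and always act on sets with more than one element. For permutation groups $(A,V)$ and $(B,W)$, the (imprimitive) wreath product $A\wr B$ is the permutation group on $V\times W$ consisting of all permutations $\gamma$ for which there are $\alpha_w\in A$ ($w\in W$) and $\beta\in B$ with $(v,w)\gamma=(v\alpha_w,w\beta)$ for all $(v,w)$. For colored graphs $G_2=(W,E_2)$ and $G_1=(V,E_1)$, the composition $G_2\circ G_1$ is the colored graph on $W\times V$ in which the edge $\{(w_1,v_1),(w_2,v_2)\}$ has color $c$ if either $w_1\neq w_2$ and $E_2\{w_1,w_2\}=c$, or $w_1=w_2$ and $E_1\{v_1,v_2\}=c$. *)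

theory Defs
  imports "HOL-Algebra.Bij" "HOL-Library.Ramsey"
begin

text \<open>
  Permutations of \<open>V\<close> are the elements of \<^term>\<open>Bij V\<close>, i.e. bijections of \<open>V\<close> that are
  undefined outside \<open>V\<close>. They are applied as functions on the left; writing
  them on the right instead gives the same sets of permutations.
\<close>

definition perm_group :: "('v \<Rightarrow> 'v) set \<Rightarrow> 'v set \<Rightarrow> bool" where
  "perm_group A V \<longleftrightarrow> subgroup A (BijGroup V) \<and> (\<exists>x\<in>V. \<exists>y\<in>V. x \<noteq> y)"

definition perm_isomorphic ::
  "('v \<Rightarrow> 'v) set \<Rightarrow> 'v set \<Rightarrow> ('w \<Rightarrow> 'w) set \<Rightarrow> 'w set \<Rightarrow> bool" where
  "perm_isomorphic A V B W \<longleftrightarrow>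
     (\<exists>\<phi> \<psi>. bij_betw \<phi> V W \<and>
            \<psi> \<in> iso (BijGroup V\<lparr>carrier := A\<rparr>) (BijGroup W\<lparr>carrier := B\<rparr>) \<and>
            (\<forall>\<sigma>\<in>A. \<forall>v\<in>V. \<phi> (\<sigma> v) = \<psi> \<sigma> (\<phi> v)))"

definition wreath ::
  "('v \<Rightarrow> 'v) set \<Rightarrow> 'v set \<Rightarrow> ('w \<Rightarrow> 'w) set \<Rightarrow> 'w set \<Rightarrow> ('v \<times> 'w \<Rightarrow> 'v \<times> 'w) set" where
  "wreath A V B W =
     {\<gamma> \<in> Bij (V \<times> W). \<exists>\<alpha> \<beta>. (\<forall>w\<in>W. \<alpha> w \<in> A) \<and> \<beta> \<in> B \<and>
        (\<forall>v\<in>V. \<forall>w\<in>W. \<gamma> (v, w) = (\<alpha> w v, \<beta> w))}"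

text \<open>
  A colored graph is a pair of a vertex set \<open>V\<close> and an edge coloring. Only the
  values of the coloring on \<^term>\<open>nsets V 2\<close>, the set of unordered pairs of distinct
  vertices, are relevant. The \<open>r\<close> colors are the numbers below \<open>r\<close>.
\<close>

type_synonym 'v cgraph = "'v set \<times> ('v set \<Rightarrow> nat)"

abbreviation verts :: "'v cgraph \<Rightarrow> 'v set" where
  "verts G \<equiv> fst G"

abbreviation color :: "'v cgraph \<Rightarrow> 'v set \<Rightarrow> nat" where
  "color G \<equiv> snd G"

definition colored_graph :: "nat \<Rightarrow> 'v cgraph \<Rightarrow> bool" where
  "colored_graph r G \<longleftrightarrow> color G \<in> nsets (verts G) 2 \<rightarrow> {..<r}"

definition Aut :: "'v cgraph \<Rightarrow> ('v \<Rightarrow> 'v) set" where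
  "Aut G = {\<sigma> \<in> Bij (verts G).
     \<forall>v\<in>verts G. \<forall>w\<in>verts G. v \<noteq> w \<longrightarrow> color G {v, w} = color G {\<sigma> v, \<sigma> w}}"

definition vertex_transitive :: "'v cgraph \<Rightarrow> bool" where
  "vertex_transitive G \<longleftrightarrow> (\<forall>v\<in>verts G. \<forall>w\<in>verts G. \<exists>\<sigma>\<in>Aut G. \<sigma> v = w)"

definition cgraph_isomorphic :: "'v cgraph \<Rightarrow> 'w cgraph \<Rightarrow> bool" where
  "cgraph_isomorphic G H \<longleftrightarrow>
     (\<exists>\<phi>. bij_betw \<phi> (verts G) (verts H) \<and>
        (\<forall>v\<in>verts G. \<forall>w\<in>verts G. v \<noteq> w \<longrightarrow> color G {v, w} = color H {\<phi> v, \<phi> w}))"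

text \<open>
  For an edge \<open>e\<close> of the composition with endpoints \<open>(w1, v1)\<close> and \<open>(w2, v2)\<close>, the set
  \<open>fst ` e\<close> is \<open>{w1, w2}\<close>, which is a singleton exactly when \<open>w1 = w2\<close>, and \<open>snd ` e\<close> is
  \<open>{v1, v2}\<close>; see the two lemmas below.
\<close>

definition graph_comp :: "'w cgraph \<Rightarrow> 'v cgraph \<Rightarrow> ('w \<times> 'v) cgraph" where
  "graph_comp G2 G1 =
     (verts G2 \<times> verts G1,
      \<lambda>e. if is_singleton (fst ` e) then color G1 (snd ` e) else color G2 (fst ` e))"

lemma color_graph_comp_diff:
  "w1 \<noteq> w2 \<Longrightarrow> color (graph_comp G2 G1) {(w1, v1), (w2, v2)} = color G2 {w1, w2}"
  by (auto simp: graph_comp_def is_singleton_def)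

lemma color_graph_comp_same:
  "color (graph_comp G2 G1) {(w, v1), (w, v2)} = color G1 {v1, v2}"
  by (simp add: graph_comp_def)

end

theory Submission imports Defs begin

text \<open>
  Up to isomorphism \<open>G\<close> lives on \<open>V \<times> W\<close> and its automorphism group equals
  \<open>A \<wr> B\<close>; transitivity of \<open>G\<close> makes \<open>A\<close> and \<open>B\<close> transitive. Since the elements of
  \<open>A\<close> acting on two distinct blocks can be chosen independently, the color of an edge
  between the blocks of \<open>w1\<close> and \<open>w2\<close> depends only on \<open>{w1, w2}\<close>; since \<open>B\<close> permutes
  the blocks transitively, all blocks carry the same coloring. This yields \<open>H2\<close> and \<open>H1\<close>.
  Finally, an automorphism of \<open>H1\<close> acting on a single block, and an automorphism of
  \<open>H2\<close> permuting the blocks, are automorphisms of \<open>G\<close>, hence lie in \<open>A \<wr> B\<close>.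
\<close>

section \<open>Automorphisms of colored graphs and permutations of a set\<close>

lemma colored_graph_iff:
  "colored_graph r G \<longleftrightarrow>
     (\<forall>v\<in>verts G. \<forall>w\<in>verts G. v \<noteq> w \<longrightarrow> color G {v, w} < r)"
  unfolding colored_graph_def nsets_2_eq by (auto simp: Pi_iff)

lemma Aut_iff:
  "\<sigma> \<in> Aut G \<longleftrightarrow> \<sigma> \<in> Bij (verts G) \<and>
     (\<forall>v\<in>verts G. \<forall>w\<in>verts G. v \<noteq> w \<longrightarrow> color G {\<sigma> v, \<sigma> w} = color G {v, w})"
  unfolding Aut_def by (auto simp: eq_commute)

lemma AutD:
  "\<lbrakk>\<sigma> \<in> Aut G; v \<in> verts G; w \<in> verts G; v \<noteq> w\<rbrakk> \<Longrightarrow> color G {\<sigma> v, \<sigma> w} = color G {v, w}"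
  by (simp add: Aut_iff)

lemma Bij_eqI:
  assumes "f \<in> Bij S" "g \<in> Bij S" "\<And>x. x \<in> S \<Longrightarrow> f x = g x"
  shows "f = g"
  using assms by (auto simp: Bij_def intro: extensionalityI)

lemma Bij_mem: "f \<in> Bij S \<Longrightarrow> x \<in> S \<Longrightarrow> f x \<in> S"
  by (auto simp: Bij_def bij_betw_def)

lemma Bij_eq_iff: "f \<in> Bij S \<Longrightarrow> x \<in> S \<Longrightarrow> y \<in> S \<Longrightarrow> f x = f y \<longleftrightarrow> x = y"
  by (auto simp: Bij_def bij_betw_def inj_on_def)

lemma Bij_surjE:
  assumes "f \<in> Bij S" "y \<in> S"
  obtains x where "x \<in> S" "f x = y"
proof -
  from assms have "y \<in> f ` S" by (simp add: Bij_def bij_betw_def)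
  then show thesis using that by blast
qed

lemma perm_group_subset: "perm_group A V \<Longrightarrow> A \<subseteq> Bij V"
  using subgroup.subset[of A "BijGroup V"] by (simp add: perm_group_def BijGroup_def)

lemma perm_group_id: "perm_group A V \<Longrightarrow> (\<lambda>x\<in>V. x) \<in> A"
  unfolding perm_group_def BijGroup_def by (auto dest: subgroup.one_closed)

section \<open>Elements of the wreath product\<close>

text \<open>\<open>\<beta>\<close> determines the block, and within a block
  \<open>\<alpha> w\<close> determines the point; a preimage is found in the same order. Arbitrary
  bijections are allowed because the lemma is also needed for automorphisms of \<open>H1\<close> and
  \<open>H2\<close> not yet known to lie in \<open>A\<close> and \<open>B\<close>.\<close>

lemma Bij_wreath:
  assumes \<alpha>: "\<And>w. w \<in> W \<Longrightarrow> \<alpha> w \<in> Bij V" and \<beta>: "\<beta> \<in> Bij W"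
  shows "(\<lambda>(v, w)\<in>V \<times> W. (\<alpha> w v, \<beta> w)) \<in> Bij (V \<times> W)"
proof -
  let ?g = "\<lambda>(v, w)\<in>V \<times> W. (\<alpha> w v, \<beta> w)"
  have "inj_on ?g (V \<times> W)"
    using Bij_eq_iff[OF \<beta>] Bij_eq_iff[OF \<alpha>] by (auto simp: inj_on_def)
  moreover have "?g ` (V \<times> W) = V \<times> W"
  proof
    show "?g ` (V \<times> W) \<subseteq> V \<times> W"
      using Bij_mem[OF \<beta>] Bij_mem[OF \<alpha>] by auto
    show "V \<times> W \<subseteq> ?g ` (V \<times> W)"
    proof clarify
      fix v w assume v: "v \<in> V" and w: "w \<in> W"
      from \<beta> w obtain w' where w': "w' \<in> W" "\<beta> w' = w"
        by (blast elim: Bij_surjE)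
      from \<alpha>[OF w'(1)] v obtain v' where v': "v' \<in> V" "\<alpha> w' v' = v"
        by (blast elim: Bij_surjE)
      show "(v, w) \<in> ?g ` (V \<times> W)"
        by (rule image_eqI[of _ _ "(v', w')"]) (use v' w' in auto)
    qed
  qed
  ultimately show ?thesis
    by (simp add: Bij_def bij_betw_def)
qed

lemma wreathI:
  assumes "perm_group A V" "perm_group B W" "\<And>w. w \<in> W \<Longrightarrow> \<alpha> w \<in> A" "\<beta> \<in> B"
  shows "(\<lambda>(v, w)\<in>V \<times> W. (\<alpha> w v, \<beta> w)) \<in> wreath A V B W"
proof -
  have "(\<lambda>(v, w)\<in>V \<times> W. (\<alpha> w v, \<beta> w)) \<in> Bij (V \<times> W)"
    using assms perm_group_subset[of A V] perm_group_subset[of B W]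
    by (intro Bij_wreath) blast+
  then show ?thesis
    unfolding wreath_def using assms(3,4) by (auto intro!: exI[of _ \<alpha>] exI[of _ \<beta>])
qed

lemma wreathE:
  assumes "\<gamma> \<in> wreath A V B W"
  obtains \<alpha> \<beta> where "\<And>w. w \<in> W \<Longrightarrow> \<alpha> w \<in> A" "\<beta> \<in> B"
    "\<And>v w. v \<in> V \<Longrightarrow> w \<in> W \<Longrightarrow> \<gamma> (v, w) = (\<alpha> w v, \<beta> w)"
  using assms unfolding wreath_def by blast

section \<open>Transport of graphs and transitivity along isomorphisms\<close>

text \<open>Turns permutation isomorphism into equality: relabelling the vertices along \<phi>
  conjugates \<open>Aut G\<close> by \<phi>, and equivariance says that \<psi> is exactly this
  conjugation.\<close>

lemma perm_isomorphic_Aut_transport: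
  fixes G :: "'a cgraph" and X :: "'x set"
  assumes iso: "perm_isomorphic (Aut G) (verts G) P X" and P: "P \<subseteq> Bij X"
  obtains H where "verts H = X" "Aut H = P" "cgraph_isomorphic G H"
proof -
  let ?U = "verts G"
  from iso obtain \<phi> \<psi> where \<phi>: "bij_betw \<phi> ?U X"
    and "\<psi> \<in> iso (BijGroup ?U\<lparr>carrier := Aut G\<rparr>) (BijGroup X\<lparr>carrier := P\<rparr>)"
    and eq: "\<And>\<sigma> v. \<sigma> \<in> Aut G \<Longrightarrow> v \<in> ?U \<Longrightarrow> \<phi> (\<sigma> v) = \<psi> \<sigma> (\<phi> v)"
    unfolding perm_isomorphic_def by blast
  then have \<psi>: "bij_betw \<psi> (Aut G) P"
    by (simp add: iso_def)
  define \<theta> where "\<theta> = inv_into ?U \<phi>"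
  have \<theta>: "bij_betw \<theta> X ?U"
    unfolding \<theta>_def by (rule bij_betw_inv_into[OF \<phi>])
  have \<theta>\<phi>: "\<theta> (\<phi> v) = v" if "v \<in> ?U" for v
    using \<phi> that unfolding \<theta>_def by (rule bij_betw_inv_into_left)
  have \<phi>\<theta>: "\<phi> (\<theta> x) = x" if "x \<in> X" for x
    using \<phi> that unfolding \<theta>_def by (rule bij_betw_inv_into_right)
  have \<phi>X: "\<phi> v \<in> X" if "v \<in> ?U" for v using \<phi> that by (rule bij_betw_apply)
  have \<theta>U: "\<theta> x \<in> ?U" if "x \<in> X" for x using \<theta> that by (rule bij_betw_apply)
  define H where "H = (X, \<lambda>e. color G (\<theta> ` e))"
  have H: "verts H = X" "\<And>x y. color H {x, y} = color G {\<theta> x, \<theta> y}"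
    by (simp_all add: H_def)
  have "cgraph_isomorphic G H"
    unfolding cgraph_isomorphic_def using \<phi> \<theta>\<phi> H by (intro exI[of _ \<phi>]) simp
  moreover have "Aut H = P"
  proof
    show "P \<subseteq> Aut H"
    proof
      fix \<tau> assume "\<tau> \<in> P"
      with \<psi> obtain \<sigma> where \<sigma>: "\<sigma> \<in> Aut G" "\<tau> = \<psi> \<sigma>"
        by (auto simp: bij_betw_def)
      \<comment> \<open>Through \<theta>, the action of \<tau> on \<open>X\<close> becomes that of
        the automorphism \<sigma>, so \<tau> preserves the pulled-back colors.\<close>
      have "\<theta> (\<tau> x) = \<sigma> (\<theta> x)" if "x \<in> X" for x
      proof -
        have "\<tau> x = \<phi> (\<sigma> (\<theta> x))"
          using eq[OF \<sigma>(1) \<theta>U[OF that]] \<sigma>(2) \<phi>\<theta>[OF that] by simp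
        moreover have "\<sigma> (\<theta> x) \<in> ?U"
          using \<sigma>(1) \<theta>U[OF that] by (auto simp: Aut_iff intro: Bij_mem)
        ultimately show ?thesis by (simp add: \<theta>\<phi>)
      qed
      moreover have "\<theta> x \<noteq> \<theta> y" if "x \<in> X" "y \<in> X" "x \<noteq> y" for x y
        using that \<phi>\<theta> by metis
      ultimately show "\<tau> \<in> Aut H"
        using \<open>\<tau> \<in> P\<close> P AutD[OF \<sigma>(1)] \<theta>U by (auto simp: Aut_iff H)
    qed
  next
    show "Aut H \<subseteq> P"
    proof
      fix \<tau> assume \<tau>: "\<tau> \<in> Aut H"
      then have \<tau>X: "\<tau> \<in> Bij X" by (simp add: Aut_iff H)
      \<comment> \<open>Conjugating \<tau> back gives an automorphism of \<open>G\<close>;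
        \<open>restrict\<close> makes it undefined outside the vertex set, as \<open>Bij\<close>
        demands. Its image under \<psi> then turns out to be \<tau>.\<close>
      define \<sigma> where "\<sigma> = restrict (\<theta> \<circ> \<tau> \<circ> \<phi>) ?U"
      have "bij_betw (\<theta> \<circ> \<tau> \<circ> \<phi>) ?U ?U"
        using \<tau>X \<phi> \<theta> by (auto simp: Bij_def intro!: bij_betw_trans)
      then have "\<sigma> \<in> Bij ?U"
        by (simp add: Bij_def \<sigma>_def)
      moreover have "color G {\<sigma> v, \<sigma> w} = color G {v, w}"
        if "v \<in> ?U" "w \<in> ?U" "v \<noteq> w" for v w
      proof -
        have "\<phi> v \<noteq> \<phi> w" using that \<theta>\<phi> by metis
        then show ?thesis
          using AutD[OF \<tau>, of "\<phi> v" "\<phi> w"] that by (simp add: H \<phi>X \<theta>\<phi> \<sigma>_def)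
      qed
      ultimately have \<sigma>: "\<sigma> \<in> Aut G" by (simp add: Aut_iff)
      then have "\<psi> \<sigma> \<in> P" using \<psi> by (rule bij_betw_apply[rotated])
      moreover have "\<psi> \<sigma> x = \<tau> x" if "x \<in> X" for x
      proof -
        have "\<psi> \<sigma> x = \<phi> (\<sigma> (\<theta> x))"
          using eq[OF \<sigma> \<theta>U[OF that]] by (simp add: \<phi>\<theta> that)
        also have "\<dots> = \<tau> x"
          using that Bij_mem[OF \<tau>X that] by (simp add: \<sigma>_def \<theta>U \<phi>\<theta>)
        finally show ?thesis .
      qed
      ultimately show "\<tau> \<in> P"
        using Bij_eqI[OF _ \<tau>X, of "\<psi> \<sigma>"] P by auto
    qed
  qed
  ultimately show thesis using that H by blast
qed

lemma cgraph_isomorphicE: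
  assumes "cgraph_isomorphic G H"
  obtains \<phi> where "bij_betw \<phi> (verts G) (verts H)"
    "\<And>v w. v \<in> verts G \<Longrightarrow> w \<in> verts G \<Longrightarrow> v \<noteq> w \<Longrightarrow>
       color H {\<phi> v, \<phi> w} = color G {v, w}"
  using assms unfolding cgraph_isomorphic_def by fastforce

lemma cgraph_isomorphic_colored_graph:
  assumes "cgraph_isomorphic G H" "colored_graph r G"
  shows "colored_graph r H"
proof -
  from assms(1) obtain \<phi> where \<phi>: "bij_betw \<phi> (verts G) (verts H)"
    "\<And>v w. v \<in> verts G \<Longrightarrow> w \<in> verts G \<Longrightarrow> v \<noteq> w \<Longrightarrow>
       color H {\<phi> v, \<phi> w} = color G {v, w}"
    by (rule cgraph_isomorphicE) blast
  have "verts H = \<phi> ` verts G"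
    using \<phi>(1) by (simp add: bij_betw_def)
  then show ?thesis
    using \<phi>(2) assms(2) unfolding colored_graph_iff by auto metis
qed

lemma cgraph_isomorphic_trans:
  assumes "cgraph_isomorphic G H" "cgraph_isomorphic H K"
  shows "cgraph_isomorphic G K"
proof -
  from assms(1) obtain \<phi> where \<phi>: "bij_betw \<phi> (verts G) (verts H)"
    "\<And>v w. v \<in> verts G \<Longrightarrow> w \<in> verts G \<Longrightarrow> v \<noteq> w \<Longrightarrow>
       color H {\<phi> v, \<phi> w} = color G {v, w}"
    by (rule cgraph_isomorphicE) blast
  from assms(2) obtain \<psi> where \<psi>: "bij_betw \<psi> (verts H) (verts K)"
    "\<And>v w. v \<in> verts H \<Longrightarrow> w \<in> verts H \<Longrightarrow> v \<noteq> w \<Longrightarrow>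
       color K {\<psi> v, \<psi> w} = color H {v, w}"
    by (rule cgraph_isomorphicE) blast
  have "color G {v, w} = color K {\<psi> (\<phi> v), \<psi> (\<phi> w)}"
    if "v \<in> verts G" "w \<in> verts G" "v \<noteq> w" for v w
  proof -
    have "\<phi> v \<in> verts H" "\<phi> w \<in> verts H" "\<phi> v \<noteq> \<phi> w"
      using \<phi>(1) that by (auto simp: bij_betw_def inj_on_def)
    then show ?thesis using \<phi>(2)[OF that] \<psi>(2) by simp
  qed
  then show ?thesis
    unfolding cgraph_isomorphic_def
    using bij_betw_trans[OF \<phi>(1) \<psi>(1)] by (intro exI[of _ "\<psi> \<circ> \<phi>"]) simp
qed

text \<open>Pull both points back to \<open>V\<close>, connect them there, and push the connecting
  permutation forward by \<psi>. This carries vertex transitivity from \<open>G\<close> to its copy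
  on \<open>V \<times> W\<close>.\<close>

lemma perm_isomorphic_transitive:
  assumes iso: "perm_isomorphic A V B W"
    and trans: "\<And>v v'. v \<in> V \<Longrightarrow> v' \<in> V \<Longrightarrow> \<exists>\<sigma>\<in>A. \<sigma> v = v'"
    and w: "w \<in> W" "w' \<in> W"
  shows "\<exists>\<tau>\<in>B. \<tau> w = w'"
proof -
  from iso obtain \<phi> \<psi> where \<phi>: "bij_betw \<phi> V W"
    and \<psi>: "\<psi> \<in> iso (BijGroup V\<lparr>carrier := A\<rparr>) (BijGroup W\<lparr>carrier := B\<rparr>)"
    and eq: "\<And>\<sigma> v. \<sigma> \<in> A \<Longrightarrow> v \<in> V \<Longrightarrow> \<phi> (\<sigma> v) = \<psi> \<sigma> (\<phi> v)"
    unfolding perm_isomorphic_def by blast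
  from w \<phi> obtain v v' where v: "v \<in> V" "v' \<in> V" "w = \<phi> v" "w' = \<phi> v'"
    by (auto simp: bij_betw_def)
  with trans obtain \<sigma> where "\<sigma> \<in> A" "\<sigma> v = v'" by blast
  moreover from this \<psi> have "\<psi> \<sigma> \<in> B" by (auto simp: iso_def bij_betw_def)
  ultimately show ?thesis using eq v by metis
qed

section \<open>Decomposition of a graph whose group is literally a wreath product\<close>

lemma Aut_wreath_graph_comp:
  fixes G :: "('v \<times> 'w) cgraph"
  assumes G: "colored_graph r G" and VG: "verts G = V \<times> W"
    and Aut: "Aut G = wreath A V B W" and trans: "vertex_transitive G"
    and A: "perm_group A V" and B: "perm_group B W"
  obtains H1 :: "'v cgraph" and H2 :: "'w cgraph"
  where "colored_graph r H1" "colored_graph r H2" "verts H1 = V" "Aut H1 = A"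
    "verts H2 = W" "Aut H2 = B" "cgraph_isomorphic G (graph_comp H2 H1)"
proof -
  \<comment> \<open>\<open>w0\<close> selects a reference block, and \<open>v0\<close> a
    representative in every block.\<close>
  from A B obtain v0 w0 where v0: "v0 \<in> V" and w0: "w0 \<in> W"
    by (auto simp: perm_group_def)
  note AV = perm_group_subset[OF A] and BW = perm_group_subset[OF B]
  have gtrans: "\<exists>\<gamma>\<in>wreath A V B W. \<gamma> (v, w) = (v', w')"
    if "v \<in> V" "w \<in> W" "v' \<in> V" "w' \<in> W" for v w v' w'
    using trans that unfolding vertex_transitive_def VG Aut by blast
  \<comment> \<open>A wreath element taking \<open>(v, w0)\<close> to \<open>(v', w0)\<close> has a
    component over \<open>w0\<close> that takes \<open>v\<close> to \<open>v'\<close>. For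
    \<open>B\<close>, the first coordinate is held at \<open>v0\<close> instead.\<close>
  have Atrans: "\<exists>\<alpha>\<in>A. \<alpha> v = v'" if "v \<in> V" "v' \<in> V" for v v'
    using gtrans[OF that(1) w0 that(2) w0] that w0 by (force elim!: wreathE)
  have Btrans: "\<exists>\<beta>\<in>B. \<beta> w = w'" if "w \<in> W" "w' \<in> W" for w w'
    using gtrans[OF v0 that(1) v0 that(2)] that v0 by (force elim!: wreathE)
  \<comment> \<open>The color identities \<open>diff\<close> and \<open>same\<close> are instances
    of this one, for suitable choices of \<alpha> and \<beta>.\<close>
  have inv: "color G {(\<alpha> w1 v1, \<beta> w1), (\<alpha> w2 v2, \<beta> w2)} = color G {(v1, w1), (v2, w2)}"
    if "\<And>w. w \<in> W \<Longrightarrow> \<alpha> w \<in> A" "\<beta> \<in> B" "v1 \<in> V" "v2 \<in> V" "w1 \<in> W" "w2 \<in> W"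
      "(v1, w1) \<noteq> (v2, w2)" for \<alpha> \<beta> v1 v2 w1 w2
  proof -
    have "(\<lambda>(v, w)\<in>V \<times> W. (\<alpha> w v, \<beta> w)) \<in> Aut G"
      unfolding Aut using that by (intro wreathI A B)
    from AutD[OF this, of "(v1, w1)" "(v2, w2)"] show ?thesis
      using that(3-) by (simp add: VG)
  qed
  have diff: "color G {(v1, w1), (v2, w2)} = color G {(v0, w1), (v0, w2)}"
    if v: "v1 \<in> V" "v2 \<in> V" and w: "w1 \<in> W" "w2 \<in> W" "w1 \<noteq> w2" for v1 v2 w1 w2
  proof -
    \<comment> \<open>As \<open>w1 \<noteq> w2\<close>, a single wreath element can act by
      \<open>a1\<close> over \<open>w1\<close> and by \<open>a2\<close> over \<open>w2\<close> while
      fixing every block.\<close>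
    obtain a1 a2 where "a1 \<in> A" "a2 \<in> A" "a1 v0 = v1" "a2 v0 = v2"
      using Atrans v v0 by metis
    then show ?thesis
      using inv[of "\<lambda>w. if w = w1 then a1 else a2" "\<lambda>w\<in>W. w" v0 v0 w1 w2]
        perm_group_id[OF B] v0 w by simp
  qed
  have same: "color G {(v1, w), (v2, w)} = color G {(v1, w0), (v2, w0)}"
    if v: "v1 \<in> V" "v2 \<in> V" "v1 \<noteq> v2" and w: "w \<in> W" for v1 v2 w
  proof -
    obtain \<beta> where "\<beta> \<in> B" "\<beta> w0 = w" using Btrans w w0 by metis
    then show ?thesis
      using inv[of "\<lambda>_. \<lambda>v\<in>V. v" \<beta> v1 v2 w0 w0] perm_group_id[OF A] v w0 by simp
  qed
  \<comment> \<open>\<open>H1\<close> copies the coloring of the block over \<open>w0\<close>, and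
    \<open>H2\<close> that of the transversal of representatives \<open>(v0, w)\<close>. By
    \<open>same\<close> and \<open>diff\<close> these samples determine all of
    \<open>G\<close>.\<close>
  define H1 where "H1 = (V, \<lambda>e. color G ((\<lambda>v. (v, w0)) ` e))"
  define H2 where "H2 = (W, \<lambda>e. color G ((\<lambda>w. (v0, w)) ` e))"
  have H1: "verts H1 = V" "\<And>v1 v2. color H1 {v1, v2} = color G {(v1, w0), (v2, w0)}"
    by (simp_all add: H1_def)
  have H2: "verts H2 = W" "\<And>w1 w2. color H2 {w1, w2} = color G {(v0, w1), (v0, w2)}"
    by (simp_all add: H2_def)
  have "colored_graph r H1" "colored_graph r H2"
    using G v0 w0 by (auto simp: colored_graph_iff H1 H2 VG)
  moreover have "Aut H1 = A"
  proof
    show "A \<subseteq> Aut H1"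
    proof
      fix \<alpha> assume \<alpha>: "\<alpha> \<in> A"
      have "color G {(\<alpha> v1, w0), (\<alpha> v2, w0)} = color G {(v1, w0), (v2, w0)}"
        if "v1 \<in> V" "v2 \<in> V" "v1 \<noteq> v2" for v1 v2
        using inv[of "\<lambda>_. \<alpha>" "\<lambda>w\<in>W. w" v1 v2 w0 w0] \<alpha> that w0 perm_group_id[OF B] by simp
      then show "\<alpha> \<in> Aut H1" using \<alpha> AV by (auto simp: Aut_iff H1)
    qed
    show "Aut H1 \<subseteq> A"
    proof
      fix \<sigma> assume \<sigma>: "\<sigma> \<in> Aut H1"
      then have \<sigma>V: "\<sigma> \<in> Bij V" by (simp add: Aut_iff H1)
      \<comment> \<open>Let \<sigma> act on the reference block alone. The wreath component over
        \<open>w0\<close> of the resulting \<gamma> is then \<sigma> itself.\<close>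
      define s where "s w = (if w = w0 then \<sigma> else (\<lambda>v\<in>V. v))" for w
      define \<gamma> where "\<gamma> = (\<lambda>(v, w)\<in>V \<times> W. (s w v, (\<lambda>w\<in>W. w) w))"
      have s: "s w \<in> Bij V" for w using \<sigma>V by (simp add: s_def id_Bij)
      have "\<gamma> \<in> Bij (V \<times> W)"
        unfolding \<gamma>_def using s id_Bij by (rule Bij_wreath)
      moreover have "color G {\<gamma> (v1, w1), \<gamma> (v2, w2)} = color G {(v1, w1), (v2, w2)}"
        if "v1 \<in> V" "v2 \<in> V" "w1 \<in> W" "w2 \<in> W" "(v1, w1) \<noteq> (v2, w2)" for v1 v2 w1 w2
      proof (cases "w1 = w2")
        case False
        then show ?thesis
          \<comment> \<open>Blocks stay in place, so the edge before and the edge after both have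
            the color of the representatives over \<open>w1\<close> and \<open>w2\<close>.\<close>
          using that diff[of v1 v2 w1 w2] diff[of "s w1 v1" "s w2 v2" w1 w2] Bij_mem[OF s]
          by (simp add: \<gamma>_def)
      next
        case True
        then show ?thesis
          using that AutD[OF \<sigma>, of v1 v2] by (simp add: \<gamma>_def s_def H1)
      qed
      ultimately have "\<gamma> \<in> wreath A V B W"
        unfolding Aut[symmetric] Aut_iff VG by auto
      then obtain \<alpha> \<beta> where \<alpha>: "\<alpha> w0 \<in> A" "\<And>v. v \<in> V \<Longrightarrow> \<gamma> (v, w0) = (\<alpha> w0 v, \<beta> w0)"
        using w0 by (auto elim!: wreathE)
      have "\<sigma> = \<alpha> w0"
        by (rule Bij_eqI[OF \<sigma>V]) (use \<alpha> AV w0 in \<open>auto simp: \<gamma>_def s_def\<close>)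
      with \<alpha> show "\<sigma> \<in> A" by simp
    qed
  qed
  moreover have "Aut H2 = B"
  proof
    show "B \<subseteq> Aut H2"
    proof
      fix \<beta> assume \<beta>: "\<beta> \<in> B"
      have "color G {(v0, \<beta> w1), (v0, \<beta> w2)} = color G {(v0, w1), (v0, w2)}"
        if "w1 \<in> W" "w2 \<in> W" "w1 \<noteq> w2" for w1 w2
        using inv[of "\<lambda>_. \<lambda>v\<in>V. v" \<beta> v0 v0 w1 w2] \<beta> that v0 perm_group_id[OF A] by simp
      then show "\<beta> \<in> Aut H2" using \<beta> BW by (auto simp: Aut_iff H2)
    qed
    show "Aut H2 \<subseteq> B"
    proof
      fix \<tau> assume \<tau>: "\<tau> \<in> Aut H2"
      then have \<tau>W: "\<tau> \<in> Bij W" by (simp add: Aut_iff H2)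
      \<comment> \<open>Let \<tau> permute whole blocks, keeping first coordinates. Edges between
        blocks keep their color because \<tau> preserves \<open>H2\<close>, edges inside a block by
        \<open>same\<close>. The identity is written as a restricted function to fit the shape of
        \<open>Bij_wreath\<close>.\<close>
      define \<gamma> where "\<gamma> = (\<lambda>(v, w)\<in>V \<times> W. ((\<lambda>v\<in>V. v) v, \<tau> w))"
      have "\<gamma> \<in> Bij (V \<times> W)"
        unfolding \<gamma>_def using id_Bij \<tau>W by (rule Bij_wreath)
      moreover have "color G {\<gamma> (v1, w1), \<gamma> (v2, w2)} = color G {(v1, w1), (v2, w2)}"
        if "v1 \<in> V" "v2 \<in> V" "w1 \<in> W" "w2 \<in> W" "(v1, w1) \<noteq> (v2, w2)" for v1 v2 w1 w2
      proof (cases "w1 = w2")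
        case False
        then show ?thesis
          using that diff[of v1 v2 w1 w2] diff[of v1 v2 "\<tau> w1" "\<tau> w2"]
            AutD[OF \<tau>, of w1 w2] Bij_mem[OF \<tau>W] Bij_eq_iff[OF \<tau>W]
          by (simp add: \<gamma>_def H2)
      next
        case True
        then show ?thesis
          using that same[of v1 v2 w1] same[of v1 v2 "\<tau> w1"] Bij_mem[OF \<tau>W]
          by (simp add: \<gamma>_def)
      qed
      ultimately have "\<gamma> \<in> wreath A V B W"
        unfolding Aut[symmetric] Aut_iff VG by auto
      then obtain \<beta> where \<beta>: "\<beta> \<in> B" "\<And>w. w \<in> W \<Longrightarrow> snd (\<gamma> (v0, w)) = \<beta> w"
        using v0 by (auto elim!: wreathE)
      have "\<tau> = \<beta>"
        by (rule Bij_eqI[OF \<tau>W]) (use \<beta> BW v0 in \<open>auto simp: \<gamma>_def\<close>)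
      with \<beta> show "\<tau> \<in> B" by simp
    qed
  qed
  moreover have "cgraph_isomorphic G (graph_comp H2 H1)"
    unfolding cgraph_isomorphic_def
  \<comment> \<open>The block index is the second coordinate in the wreath product but the first in
    the composition.\<close>
  proof (intro exI[of _ prod.swap] conjI)
    show "bij_betw prod.swap (verts G) (verts (graph_comp H2 H1))"
      by (auto simp: bij_betw_def VG H1 H2 graph_comp_def product_swap)
    have "color G {(v1, w1), (v2, w2)} = color (graph_comp H2 H1) {(w1, v1), (w2, v2)}"
      if "v1 \<in> V" "v2 \<in> V" "w1 \<in> W" "w2 \<in> W" "(v1, w1) \<noteq> (v2, w2)" for v1 v2 w1 w2
    proof (cases "w1 = w2")
      case False
      then show ?thesis
        using that diff[of v1 v2 w1 w2] color_graph_comp_diff[of w1 w2 H2 H1 v1 v2]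
        by (simp del: snd_conv add: H2)
    next
      case True
      then show ?thesis
        using that same[of v1 v2 w1] by (simp add: color_graph_comp_same H1)
    qed
    then show "\<forall>x\<in>verts G. \<forall>y\<in>verts G. x \<noteq> y \<longrightarrow>
        color G {x, y} = color (graph_comp H2 H1) {prod.swap x, prod.swap y}"
      unfolding VG by auto
  qed
  ultimately show thesis using that H1(1) H2(1) by blast
qed

theorem theorem2p2:
  fixes G :: "'a cgraph" and r :: nat
    and A :: "('v \<Rightarrow> 'v) set" and V :: "'v set"
    and B :: "('w \<Rightarrow> 'w) set" and W :: "'w set"
  assumes "colored_graph r G"
    and "vertex_transitive G"
    and "perm_group A V"
    and "perm_group B W"
    and "perm_isomorphic (Aut G) (verts G) (wreath A V B W) (V \<times> W)"
  shows "\<exists>(H1 :: 'v cgraph) (H2 :: 'w cgraph).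
           colored_graph r H1 \<and> colored_graph r H2 \<and>
           verts H1 = V \<and> Aut H1 = A \<and>
           verts H2 = W \<and> Aut H2 = B \<and>
           cgraph_isomorphic G (graph_comp H2 H1)"
proof -
  have "wreath A V B W \<subseteq> Bij (V \<times> W)"
    unfolding wreath_def by blast
  \<comment> \<open>\<open>G'\<close> is the relabelled copy of \<open>G\<close> to which the
    decomposition applies; the final isomorphism is composed through it.\<close>
  with assms(5) obtain G' where G': "verts G' = V \<times> W" "Aut G' = wreath A V B W"
    "cgraph_isomorphic G G'"
    by (rule perm_isomorphic_Aut_transport)
  have "vertex_transitive G'"
    unfolding vertex_transitive_def G'
    using perm_isomorphic_transitive[OF assms(5)] assms(2)
    unfolding vertex_transitive_def by blast
  with cgraph_isomorphic_colored_graph[OF G'(3) assms(1)] obtain H1 H2 where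
    "colored_graph r H1" "colored_graph r H2" "verts H1 = V" "Aut H1 = A"
    "verts H2 = W" "Aut H2 = B" "cgraph_isomorphic G' (graph_comp H2 H1)"
    using Aut_wreath_graph_comp[OF _ G'(1,2) _ assms(3,4)] by blast
  with cgraph_isomorphic_trans[OF G'(3)] show ?thesis by blast
qed

end
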